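(* For every positive integer $N$, \[ \sum_{\substack{\pi\in\mathcal{P}_{3,4}\\ |\pi|=N}} (-1)^{\nu_e(\pi)} \;-\; \sum_{\substack{\pi\in\mathcal{P}_{2,4}\\ |\pi|=N}} (-1)^{\nu_e(\pi)} \;=\; \chi(N \text{ is not a perfect square}). \]
   Context: A partition is a finite non-increasing sequence of positive integers (its parts); $|\pi|$ is the sum of its parts and $\nu_e(\pi)$ the number of even parts. For $r\in\{2,3\}$, $\mathcal{P}_{r,4}$ is the set of non-empty partitions in which every even part size occurs at most once (odd parts may repeat) and whose smallest part is congruent to $r$ modulo $4$. $\chi(S)$ is $1$ if the statement $S$ is true and $0$ otherwise. *)

theory Defs
  imports Complex_Main
begin

definition is_partition :: "nat list \<Rightarrow> bool" where
  "is_partition p \<longleftrightarrow> sorted_wrt (\<ge>) p \<and> (\<forall>x\<in>set p. x > 0)"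

definition nu_e :: "nat list \<Rightarrow> nat" where
  "nu_e p = length (filter even p)"

text \<open>\<open>Pset r\<close> is the set written \<open>P\<^sub>r\<^sub>,\<^sub>4\<close> in the mathematics, for \<open>r = 2\<close> and \<open>r = 3\<close>.
  It is infinite, but it has only finitely many members of any given \<open>sum_list\<close>, so sums
  over such members are ordinary finite sums. \<open>Min (set p)\<close> is meaningful since \<open>p \<noteq> []\<close>.\<close>

definition Pset :: "nat \<Rightarrow> nat list set" where
  "Pset r = {p. is_partition p \<and> p \<noteq> [] \<and>
     (\<forall>x. even x \<longrightarrow> count_list p x \<le> 1) \<and> Min (set p) mod 4 = r mod 4}"

end

theory Submission
  imports Defs "HOL-Computational_Algebra.Formal_Power_Series"
begin

text \<open>
  Let \<open>A\<^sub>m\<close> be the signed generating function of the partitions without repeated even parts whose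
  parts are all at least \<open>2m+1\<close>. Splitting by the smallest part, the generating function of the
  left-hand side is the sum over odd \<open>m\<close> of \<open>q^(2m) (1 + q) A\<^sub>m\<close>, that is, \<open>(1 + q)/2\<close> times the
  difference \<open>T - U\<close> of the plain and the alternating sum of \<open>q^(2m) A\<^sub>m\<close>. The recurrence
  \<open>(1 - q^(2m+1)) A\<^sub>m = (1 - q^(2m+2)) A\<^sub>m\<^sub>+\<^sub>1\<close> makes \<open>(1 - q) T\<close> telescope to 1. It also gives a
  functional equation relating the sum of \<open>z^m A\<^sub>m\<close> at \<open>z\<close> and at \<open>q^2 z\<close>; iterated from
  \<open>z = -q^2\<close>, it turns \<open>(1 + q) U\<close> into an infinite product, which Gauss' identity evaluates as
  the sum of \<open>q^(s^2)\<close> over all integers \<open>s\<close>. Infinite sums and products are avoided by working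
  modulo a power of \<open>q\<close>.
\<close>

unbundle fps_syntax

section \<open>Signed generating functions of partitions by smallest part\<close>

definition parts_ge :: "nat \<Rightarrow> nat \<Rightarrow> nat list set" where
  "parts_ge n N = {p. is_partition p \<and> (\<forall>x. even x \<longrightarrow> count_list p x \<le> 1) \<and>
     (\<forall>x\<in>set p. n \<le> x) \<and> sum_list p = N}"

text \<open>\<open>A\<^sub>m\<close> of the overview is \<open>parts_ge_fps (2*m+1)\<close>, with
  \<open>fps_X\<close> as q. The empty partition is counted.\<close>

definition parts_ge_fps :: "nat \<Rightarrow> int fps" where
  "parts_ge_fps n = Abs_fps (\<lambda>N. \<Sum>p\<in>parts_ge n N. (-1) ^ nu_e p)"

lemma is_partition_snoc:
  "is_partition (p @ [n]) \<longleftrightarrow> is_partition p \<and> (\<forall>x\<in>set p. n \<le> x) \<and> n > 0"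
  by (auto simp: is_partition_def sorted_wrt_append)

lemma nu_e_snoc: "(-1::int) ^ nu_e (p @ [n]) = - ((-1) ^ n) * (-1) ^ nu_e p"
  by (simp add: nu_e_def)

lemma finite_partitions: "finite {p. is_partition p \<and> sum_list p = N}"
proof (rule finite_subset)
  show "{p. is_partition p \<and> sum_list p = N} \<subseteq> {p. set p \<subseteq> {..N} \<and> length p \<le> N}"
  proof safe
    fix p and x :: nat assume "x \<in> set p"
    then show "x \<le> sum_list p" by (intro member_le_sum_list) auto
  next
    fix p :: "nat list" assume "is_partition p"
    then have "\<forall>x\<in>set p. x > 0" by (simp add: is_partition_def)
    then show "length p \<le> sum_list p" by (induction p) auto
  qed
  show "finite {p. set p \<subseteq> {..N} \<and> length p \<le> N}"
    by (rule finite_lists_length_le) simp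
qed

lemma finite_parts_ge [simp]: "finite (parts_ge n N)"
  by (rule finite_subset[OF _ finite_partitions[of N]]) (auto simp: parts_ge_def)

lemma count_list_snoc: "count_list (p @ [n]) x = count_list p x + of_bool (x = n)"
  by (induction p) auto

text \<open>Lists are non-increasing, so a part \<open>n\<close> that bounds all others is the last
  entry and can be removed. Further copies of \<open>n\<close> may remain only if \<open>n\<close>
  is odd; otherwise the bound rises to \<open>Suc n\<close>.\<close>

lemma parts_ge_smallest:
  assumes "n > 0" "n \<le> N"
  shows "{p \<in> parts_ge n N. n \<in> set p} =
    (\<lambda>p. p @ [n]) ` parts_ge (if odd n then n else Suc n) (N - n)"
proof (intro equalityI subsetI)
  fix p assume p: "p \<in> {p \<in> parts_ge n N. n \<in> set p}"
  then have ne: "p \<noteq> []" by auto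
  define r where "r = butlast p"
  define l where "l = last p"
  have pr: "p = r @ [l]" using ne by (simp add: r_def l_def)
  have sr: "is_partition (r @ [l])" using p pr by (simp add: parts_ge_def)
  have "l = n" using p sr unfolding pr is_partition_snoc parts_ge_def by (auto intro: le_antisym)
  then have pr: "p = r @ [n]" using pr by simp
  have "r \<in> parts_ge (if odd n then n else Suc n) (N - n)"
  proof -
    have c: "count_list (r @ [n]) x \<le> 1" if "even x" for x
      using p that unfolding pr parts_ge_def by blast
    have "n \<notin> set r" if "even n" using c[OF that] by (simp add: count_list_snoc count_list_0_iff)
    moreover have "count_list r x \<le> 1" if "even x" for x
      using c[OF that] by (simp add: count_list_snoc)
    moreover have "is_partition r" "\<forall>x\<in>set r. n \<le> x" "sum_list r = N - n"
      using p by (auto simp: pr parts_ge_def is_partition_snoc)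
    moreover have "Suc n \<le> x" if "n \<notin> set r" "x \<in> set r" "\<forall>x\<in>set r. n \<le> x" for x
      using that by (metis Suc_leI le_neq_implies_less)
    ultimately show ?thesis by (simp add: parts_ge_def)
  qed
  then show "p \<in> (\<lambda>p. p @ [n]) ` parts_ge (if odd n then n else Suc n) (N - n)"
    using pr by blast
next
  fix p assume "p \<in> (\<lambda>p. p @ [n]) ` parts_ge (if odd n then n else Suc n) (N - n)"
  then obtain r where r: "r \<in> parts_ge (if odd n then n else Suc n) (N - n)" and pr: "p = r @ [n]"
    by blast
  have r': "is_partition r" "sum_list r = N - n" "count_list r x \<le> 1" if "even x" for x
    using r that by (simp_all add: parts_ge_def)
  have ge: "\<forall>x\<in>set r. n \<le> x" "even n \<Longrightarrow> n \<notin> set r"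
  proof -
    have "\<forall>x\<in>set r. (if odd n then n else Suc n) \<le> x"
      using r by (simp add: parts_ge_def)
    then show "\<forall>x\<in>set r. n \<le> x" "even n \<Longrightarrow> n \<notin> set r"
      by (fastforce split: if_splits)+
  qed
  have "count_list p x \<le> 1" if "even x" for x
    using r'(3)[OF that] ge(2) that
    by (cases "x = n") (simp_all add: pr count_list_snoc count_list_0_iff)
  moreover have "is_partition p" "\<forall>x\<in>set p. n \<le> x" "sum_list p = N"
    \<comment> \<open>All facts in \<open>r'\<close> carry the premise \<open>even x\<close>; the
      instance 0 discharges it.\<close>
    using r'(1,2)[of 0] ge(1) assms by (simp_all add: pr is_partition_snoc)
  ultimately show "p \<in> {p \<in> parts_ge n N. n \<in> set p}"
    by (simp add: parts_ge_def pr)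
qed

text \<open>The factor \<open>- ((-1) ^ n)\<close> is the sign of the removed part: 1 if
  \<open>n\<close> is odd, -1 if it is even.\<close>

lemma sum_parts_ge_smallest:
  assumes "n > 0"
  shows "(\<Sum>p | p \<in> parts_ge n N \<and> n \<in> set p. (-1) ^ nu_e p) =
    (- ((-1) ^ n) * fps_X ^ n * parts_ge_fps (if odd n then n else Suc n)) $ N"
proof (cases "n \<le> N")
  case True
  have "(\<Sum>p | p \<in> parts_ge n N \<and> n \<in> set p. (-1::int) ^ nu_e p) =
    (\<Sum>p\<in>parts_ge (if odd n then n else Suc n) (N - n). - ((-1) ^ n) * (-1) ^ nu_e p)"
    unfolding parts_ge_smallest[OF assms True]
    by (subst sum.reindex) (auto simp: inj_on_def nu_e_snoc)
  also have "\<dots> = - ((-1) ^ n) * parts_ge_fps (if odd n then n else Suc n) $ (N - n)"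
    by (simp only: parts_ge_fps_def fps_nth_Abs_fps sum_distrib_left)
  finally show ?thesis
    using True by (cases "even n") (simp_all add: fps_X_power_mult_nth)
next
  case False
  then have empty: "{p \<in> parts_ge n N. n \<in> set p} = {}"
    by (auto simp: parts_ge_def dest: member_le_sum_list)
  show ?thesis
    unfolding empty using False by (cases "even n") (simp_all add: fps_X_power_mult_nth)
qed

lemma parts_ge_fps_split:
  assumes "n > 0"
  shows "parts_ge_fps n = parts_ge_fps (Suc n)
    - (-1) ^ n * fps_X ^ n * parts_ge_fps (if odd n then n else Suc n)"
proof (rule fps_ext)
  fix N
  have "n \<notin> set p \<and> (\<forall>x\<in>set p. n \<le> x) \<longleftrightarrow> (\<forall>x\<in>set p. Suc n \<le> x)" for p
    unfolding Suc_le_eq order_less_le by blast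
  then have "{p \<in> parts_ge n N. n \<notin> set p} = parts_ge (Suc n) N"
    unfolding parts_ge_def by blast
  then have "(\<Sum>p\<in>parts_ge n N. (-1::int) ^ nu_e p) =
      (\<Sum>p | p \<in> parts_ge n N \<and> n \<in> set p. (-1) ^ nu_e p) + (\<Sum>p\<in>parts_ge (Suc n) N. (-1) ^ nu_e p)"
    using sum.Int_Diff[of "parts_ge n N" "\<lambda>p. (-1::int) ^ nu_e p" "{p. n \<in> set p}"]
    by (simp add: Int_def set_diff_eq)
  then show "parts_ge_fps n $ N = (parts_ge_fps (Suc n)
    - (-1) ^ n * fps_X ^ n * parts_ge_fps (if odd n then n else Suc n)) $ N"
    unfolding sum_parts_ge_smallest[OF assms] by (simp add: parts_ge_fps_def)
qed

text \<open>Two splittings are combined. For the odd size, the series being split recurs on the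
  right and is moved to the left, so no division occurs; the even size contributes an explicit
  factor.\<close>

lemma parts_ge_fps_rec:
  "(1 - fps_X ^ (2*m+1)) * parts_ge_fps (2*m+1) = (1 - fps_X ^ (2*m+2)) * parts_ge_fps (2*m+3)"
proof -
  have "(1 - fps_X ^ (2*m+1)) * parts_ge_fps (2*m+1) = parts_ge_fps (2*m+2)"
    using parts_ge_fps_split[of "2*m+1"] by (simp add: algebra_simps)
  also have "\<dots> = (1 - fps_X ^ (2*m+2)) * parts_ge_fps (2*m+3)"
  proof -
    have "even (2*m+2)" "Suc (2*m+2) = 2*m+3" "(-1) ^ (2*m+2) = (1 :: int fps)" "2*m+2 > 0"
      by simp_all
    then show ?thesis
      using parts_ge_fps_split[of "2*m+2"] by (simp only: simp_thms if_False left_diff_distrib mult_1)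
  qed
  finally show ?thesis .
qed

section \<open>Congruence modulo a power of q\<close>

lemma fps_X_power_dvd_iff:
  fixes f :: "'a::comm_ring_1 fps"
  shows "fps_X ^ k dvd f \<longleftrightarrow> (\<forall>n<k. f $ n = 0)"
proof
  assume "fps_X ^ k dvd f"
  then show "\<forall>n<k. f $ n = 0" by (auto elim!: dvdE simp: fps_X_power_mult_nth)
next
  assume "\<forall>n<k. f $ n = 0"
  then have "f = fps_X ^ k * fps_shift k f"
    by (intro fps_ext) (simp add: fps_X_power_mult_nth)
  then show "fps_X ^ k dvd f" by (metis dvd_triv_left)
qed

text \<open>A factor with non-zero constant term has subdegree 0 and leaves the subdegree of a
  product unchanged. It need not be a unit, which permits cancelling 2 over the integers.\<close>

lemma fps_X_power_dvd_mult_cancel: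
  fixes f u :: "'a::idom fps"
  assumes "fps_X ^ k dvd u * f" "u $ 0 \<noteq> 0"
  shows "fps_X ^ k dvd f"
  unfolding fps_X_power_dvd_iff
proof (intro allI impI)
  fix n assume "n < k"
  show "f $ n = 0"
  proof (cases "f = 0")
    case False
    have u: "u \<noteq> 0" using assms(2) by auto
    have "(u * f) $ subdegree (u * f) \<noteq> 0" using False u by (intro nth_subdegree_nonzero) simp
    moreover have "subdegree (u * f) = subdegree f"
      using False u assms(2) by (simp add: subdegree_eq_0)
    ultimately have "k \<le> subdegree f"
      using assms(1) unfolding fps_X_power_dvd_iff by (metis not_le)
    then show ?thesis using \<open>n < k\<close> by (intro nth_less_subdegree_zero) simp
  qed simp
qed

lemma parts_ge_fps_dvd: "n > 0 \<Longrightarrow> fps_X ^ n dvd parts_ge_fps n - 1"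
  unfolding fps_X_power_dvd_iff
proof (intro allI impI)
  fix N assume "n > 0" "N < n"
  have "parts_ge n N = (if N = 0 then {[]} else {})"
  proof -
    have "p = []" if "p \<in> parts_ge n N" for p
    proof (rule ccontr)
      assume "p \<noteq> []"
      then obtain x where x: "x \<in> set p" by (cases p) auto
      then have "n \<le> x" "x \<le> N" using that by (auto simp: parts_ge_def dest: member_le_sum_list)
      then show False using \<open>N < n\<close> by simp
    qed
    moreover have "[] \<in> parts_ge n N \<longleftrightarrow> N = 0" by (auto simp: parts_ge_def is_partition_def)
    ultimately show ?thesis by auto
  qed
  then show "(parts_ge_fps n - 1) $ N = 0" by (simp add: parts_ge_fps_def nu_e_def)
qed

section \<open>Gauss' theta identity modulo a power of q\<close>

text \<open>This is Shanks' finite form of Gauss' theta identity, with the denominators cleared. It is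
  proved by induction on \<open>n\<close>: the change of the right-hand sum telescopes with alternating signs.\<close>

lemma shanks_identity:
  fixes x :: "'a::comm_ring_1"
  shows "(\<Prod>k=1..n. 1 + x ^ k) * (1 + 2 * (\<Sum>s=1..n. (-1) ^ s * x ^ s\<^sup>2)) =
    (\<Prod>k=1..n. 1 - x ^ k) +
    2 * (\<Sum>s=1..n. (-1) ^ s * x ^ (s * Suc n) * (\<Prod>k=Suc s..n. 1 - x ^ k) * (\<Prod>k=1..<s. 1 + x ^ k))"
proof (induction n)
  case (Suc n)
  \<comment> \<open>\<open>R\<close> is the telescoping certificate: the change of the summand
    \<open>t\<close> from stage \<open>n\<close> to \<open>Suc n\<close> is a difference in
    \<open>s\<close> of the signed \<open>R s\<close>.\<close>
  define R where "R s = x ^ (s * Suc n) * (\<Prod>k=s..n. 1 - x ^ k) * (\<Prod>k=1..<s. 1 + x ^ k)" for s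
  define t where "t n s = (-1) ^ s * x ^ (s * Suc n) * (\<Prod>k=Suc s..n. 1 - x ^ k) * (\<Prod>k=1..<s. 1 + x ^ k)" for n s
  have step: "t (Suc n) s - (1 + x ^ Suc n) * t n s = (-1) ^ Suc s * R (Suc s) - (-1) ^ s * R s"
    if "s \<in> {1..n}" for s
  proof -
    define A where "A = (\<Prod>k=Suc s..n. 1 - x ^ k)"
    define B where "B = (\<Prod>k=1..<s. 1 + x ^ k)"
    have 1: "(\<Prod>k=Suc s..Suc n. 1 - x ^ k) = A * (1 - x ^ Suc n)"
      using that by (simp add: A_def)
    have 2: "(\<Prod>k=s..n. 1 - x ^ k) = (1 - x ^ s) * A"
      using that by (simp add: A_def prod.atLeast_Suc_atMost)
    have 3: "(\<Prod>k=1..<Suc s. 1 + x ^ k) = B * (1 + x ^ s)"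
      using that by (simp add: B_def)
    have 4: "x ^ (s * Suc (Suc n)) = x ^ (s * Suc n) * x ^ s"
      "x ^ (Suc s * Suc n) = x ^ (s * Suc n) * x ^ Suc n"
      by (simp_all only: power_add mult_Suc mult_Suc_right mult_ac)
    \<comment> \<open>Here \<open>e\<close> is the sign, \<open>u\<close> is
      \<open>x ^ (s * Suc n)\<close>, \<open>y\<close> is \<open>x ^ s\<close> and \<open>w\<close>
      is \<open>x ^ Suc n\<close>.\<close>
    have "e * (u * y) * (A * (1 - w)) * B - (1 + w) * (e * u * A * B) =
      -1 * e * (u * w * A * (B * (1 + y))) - e * (u * ((1 - y) * A) * B)" for e u y w :: 'a
      by (simp add: algebra_simps)
    then show ?thesis
      unfolding t_def R_def 1 2 3 4 A_def[symmetric] B_def[symmetric] power_Suc[of "-1" s] .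
  qed
  have "(\<Sum>s=1..n. t (Suc n) s - (1 + x ^ Suc n) * t n s) =
    (\<Sum>s=1..n. (-1) ^ Suc s * R (Suc s) - (-1) ^ s * R s)"
    by (rule sum.cong[OF refl step])
  also have "\<dots> = (-1) ^ Suc n * R (Suc n) + R 1"
    by (subst sum_Suc_diff) auto
  finally have sum: "(\<Sum>s=1..n. t (Suc n) s) = (1 + x ^ Suc n) * (\<Sum>s=1..n. t n s)
      + (-1) ^ Suc n * R (Suc n) + R 1"
    by (simp add: sum_subtractf sum_distrib_left algebra_simps)
  have R1: "R 1 = x ^ Suc n * (\<Prod>k=1..n. 1 - x ^ k)" by (simp add: R_def)
  have Rn: "R (Suc n) = x ^ (Suc n)\<^sup>2 * (\<Prod>k=1..n. 1 + x ^ k)"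
    by (simp add: R_def power2_eq_square atLeastLessThanSuc_atLeastAtMost)
  \<comment> \<open>The term \<open>s = Suc n\<close> is new at this stage and lies outside the
    telescoping range.\<close>
  have tn: "t (Suc n) (Suc n) = (-1) ^ Suc n * x ^ (Suc n)\<^sup>2 * x ^ Suc n * (\<Prod>k=1..n. 1 + x ^ k)"
  proof -
    have "x ^ (Suc n * Suc (Suc n)) = x ^ (Suc n)\<^sup>2 * x ^ Suc n"
      by (simp only: power2_eq_square mult_Suc_right[of _ "Suc n"] power_add mult.commute)
    then show ?thesis
      unfolding t_def by (simp add: atLeastLessThanSuc_atLeastAtMost mult.assoc del: mult_Suc power_Suc)
  qed
  define P where "P = (\<Prod>k=1..n. 1 + x ^ k)"
  define M where "M = (\<Prod>k=1..n. 1 - x ^ k)"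
  define S where "S = (\<Sum>s=1..n. (-1) ^ s * x ^ s\<^sup>2)"
  define E where "E = (\<Sum>s=1..n. t n s)"
  have IH: "P * (1 + 2 * S) = M + 2 * E"
    using Suc.IH by (simp add: P_def M_def S_def E_def t_def)
  have "P * (1 + w) * (1 + 2 * (S + e * v)) =
    M * (1 - w) + 2 * ((1 + w) * E + e * (v * P) + w * M + e * v * w * P)" for e v w
  proof -
    have "P * (1 + w) * (1 + 2 * (S + e * v)) = (1 + w) * (P * (1 + 2 * S)) + 2 * e * v * P * (1 + w)"
      by (simp add: algebra_simps)
    also have "\<dots> = M * (1 - w) + 2 * ((1 + w) * E + e * (v * P) + w * M + e * v * w * P)"
      unfolding IH by (simp add: algebra_simps)
    finally show ?thesis .
  qed
  then have "P * (1 + x ^ Suc n) * (1 + 2 * (S + (-1) ^ Suc n * x ^ (Suc n)\<^sup>2)) =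
    M * (1 - x ^ Suc n) + 2 * ((1 + x ^ Suc n) * E
      + (-1) ^ Suc n * (x ^ (Suc n)\<^sup>2 * P) + x ^ Suc n * M
      + (-1) ^ Suc n * x ^ (Suc n)\<^sup>2 * x ^ Suc n * P)"
    .
  moreover have "(\<Sum>s=1..Suc n. t (Suc n) s) = (1 + x ^ Suc n) * E
      + (-1) ^ Suc n * (x ^ (Suc n)\<^sup>2 * P) + x ^ Suc n * M
      + (-1) ^ Suc n * x ^ (Suc n)\<^sup>2 * x ^ Suc n * P"
  proof -
    have "(\<Sum>s=1..Suc n. t (Suc n) s) = (\<Sum>s=1..n. t (Suc n) s) + t (Suc n) (Suc n)" by simp
    then show ?thesis unfolding sum R1 Rn tn E_def P_def M_def .
  qed
  moreover have "P * (1 + x ^ Suc n) = (\<Prod>k=1..Suc n. 1 + x ^ k)" by (simp add: P_def)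
  moreover have "M * (1 - x ^ Suc n) = (\<Prod>k=1..Suc n. 1 - x ^ k)" by (simp add: M_def)
  moreover have "S + (-1) ^ Suc n * x ^ (Suc n)\<^sup>2 = (\<Sum>s=1..Suc n. (-1) ^ s * x ^ s\<^sup>2)"
    by (simp add: S_def)
  ultimately show ?case
    by (simp only: t_def)
qed simp

lemma prod_parity_split:
  fixes x :: "'a::comm_ring_1"
  shows "(\<Prod>k=1..2*n. 1 + (- x) ^ k) = (\<Prod>i<n. 1 + x ^ (2*i+2)) * (\<Prod>i<n. 1 - x ^ (2*i+1))"
    and "(\<Prod>k=1..2*n. 1 - (- x) ^ k) = (\<Prod>i<n. 1 - x ^ (2*i+2)) * (\<Prod>i<n. 1 + x ^ (2*i+1))"
  by (induction n) (simp_all add: mult_ac)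

text \<open>Shanks' identity at \<open>- fps_X\<close>: as \<open>s\<close> and its square have
  equal parity, the signs cancel. Every term of the right-hand sum has exponent
  \<open>s * Suc (2*L)\<close> with \<open>s\<close> at least 1, so it vanishes modulo
  \<open>fps_X ^ (2*L)\<close>.\<close>

lemma gauss_identity:
  "(fps_X :: int fps) ^ (2*L) dvd (\<Prod>i<L. 1 + fps_X ^ (2*i+2)) * (\<Prod>i<L. 1 - fps_X ^ (2*i+1)) *
      (1 + 2 * (\<Sum>s=1..2*L. fps_X ^ s\<^sup>2)) -
    (\<Prod>i<L. 1 - fps_X ^ (2*i+2)) * (\<Prod>i<L. 1 + fps_X ^ (2*i+1))"
proof -
  have sign: "(-1) ^ s * (- fps_X) ^ s\<^sup>2 = (fps_X ^ s\<^sup>2 :: int fps)" for s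
    by (cases "even s") simp_all
  have *: "fps_X ^ (2*L) dvd (-1) ^ s * (- fps_X) ^ (s * Suc (2*L)) * A * B"
    if "s \<in> {1..2*L}" for s and A B :: "int fps"
  proof -
    have "2*L \<le> s * Suc (2*L)" using that by (cases s) auto
    then have "fps_X ^ (2*L) dvd (- fps_X :: int fps) ^ (s * Suc (2*L))"
      unfolding power_minus[of fps_X] by (intro dvd_mult le_imp_power_dvd)
    then show ?thesis by (rule dvd_mult2[OF dvd_mult2[OF dvd_mult]])
  qed
  show ?thesis
    using shanks_identity[of "- fps_X :: int fps" "2*L"]
    unfolding prod_parity_split sign by (simp only: add_diff_cancel_left' dvd_mult[OF dvd_sum[OF *]])
qed

section \<open>The plain and the alternating sum\<close>

lemma sum_parts_ge_fps_telescope: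
  "(1 - fps_X) * (\<Sum>m<L. fps_X ^ (2*m) * parts_ge_fps (2*m+1)) =
    (1 - fps_X ^ (2*L)) * parts_ge_fps (2*L+1)"
proof (induction L)
  case (Suc L)
  have "(1 - fps_X) * (\<Sum>m<Suc L. fps_X ^ (2*m) * parts_ge_fps (2*m+1)) =
      (1 - fps_X ^ (2*L)) * parts_ge_fps (2*L+1) + (1 - fps_X) * (fps_X ^ (2*L) * parts_ge_fps (2*L+1))"
    unfolding sum.lessThan_Suc distrib_left Suc.IH ..
  also have "\<dots> = (1 - fps_X ^ (2*L+1)) * parts_ge_fps (2*L+1)"
    by (simp add: algebra_simps)
  also have "\<dots> = (1 - fps_X ^ (2 * Suc L)) * parts_ge_fps (2 * Suc L + 1)"
    unfolding parts_ge_fps_rec by (simp add: eval_nat_numeral)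
  finally show ?case .
qed simp

text \<open>Expanded in powers of \<open>z\<close>, the coefficients of positive degree below
  \<open>L\<close> cancel by \<open>parts_ge_fps_rec\<close>, and those of degree 0 cancel
  trivially. The right-hand side is the truncation error at \<open>z ^ L\<close>.\<close>

lemma sum_parts_ge_fps_functional_equation:
  "(1 - z) * (\<Sum>m<L. z ^ m * parts_ge_fps (2*m+1)) -
    (1 - fps_X * z) * (\<Sum>m<L. (fps_X\<^sup>2 * z) ^ m * parts_ge_fps (2*m+1)) =
    - (z ^ L * ((1 - fps_X ^ (2*L)) * parts_ge_fps (2*L+1)))"
proof (induction L)
  case (Suc L)
  define a where "a = parts_ge_fps (2*L+1)"
  have "(fps_X\<^sup>2 * z) ^ L = fps_X ^ (2*L) * z ^ L"
    by (simp only: power_mult_distrib power_mult)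
  moreover have "u * (A + p) - v * (B + q) = (u * A - v * B) + u * p - v * q"
    for u v A B p q :: "int fps"
    by (simp add: algebra_simps)
  ultimately have "(1 - z) * (\<Sum>m<Suc L. z ^ m * parts_ge_fps (2*m+1)) -
      (1 - fps_X * z) * (\<Sum>m<Suc L. (fps_X\<^sup>2 * z) ^ m * parts_ge_fps (2*m+1)) =
      - (z ^ L * ((1 - fps_X ^ (2*L)) * a)) + (1 - z) * (z ^ L * a)
      - (1 - fps_X * z) * (fps_X ^ (2*L) * z ^ L * a)"
    unfolding a_def sum.lessThan_Suc by (simp only: Suc.IH)
  also have "\<dots> = - (z ^ Suc L * ((1 - fps_X ^ (2*L+1)) * a))"
    by (simp add: algebra_simps)
  also have "(1 - fps_X ^ (2*L+1)) * a = (1 - fps_X ^ (2 * Suc L)) * parts_ge_fps (2 * Suc L + 1)"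
    unfolding a_def parts_ge_fps_rec by (simp add: eval_nat_numeral)
  finally show ?case .
qed simp

text \<open>This iterates the recurrence; it is the product formula for
  \<open>parts_ge_fps 1\<close>, up to a tail factor congruent to 1.\<close>

lemma prod_mult_parts_ge_fps:
  "(\<Prod>i<L. 1 - fps_X ^ (2*i+1)) * parts_ge_fps 1 =
    (\<Prod>i<L. 1 - fps_X ^ (2*i+2)) * parts_ge_fps (2*L+1)"
proof (induction L)
  case (Suc L)
  have "(\<Prod>i<Suc L. 1 - fps_X ^ (2*i+1)) * parts_ge_fps 1 =
    (1 - fps_X ^ (2*L+1)) * ((\<Prod>i<L. 1 - fps_X ^ (2*i+1)) * parts_ge_fps 1)"
    by (simp only: prod.lessThan_Suc mult_ac)
  also have "\<dots> = (\<Prod>i<L. 1 - fps_X ^ (2*i+2)) * ((1 - fps_X ^ (2*L+1)) * parts_ge_fps (2*L+1))"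
    unfolding Suc.IH by (simp only: mult_ac)
  also have "\<dots> = (\<Prod>i<Suc L. 1 - fps_X ^ (2*i+2)) * parts_ge_fps (2 * Suc L + 1)"
    unfolding parts_ge_fps_rec by (simp add: eval_nat_numeral mult_ac)
  finally show ?case .
qed simp

lemma alternating_sum_parts_ge_fps:
  "fps_X ^ (2*L) dvd (1 + fps_X) * (\<Sum>m<L. (-1) ^ m * fps_X ^ (2*m) * parts_ge_fps (2*m+1)) -
    (1 + 2 * (\<Sum>s=1..2*L. fps_X ^ s\<^sup>2))"
proof (cases "L = 0")
  case False
  let ?X = "fps_X :: int fps"
  \<comment> \<open>\<open>G i\<close> is the sum at z equal to minus the \<open>2*i\<close>-th
    power of q; \<open>G 1\<close> is the alternating sum in question.\<close>
  define G where "G i = (\<Sum>m<L. (- (?X ^ (2*i))) ^ m * parts_ge_fps (2*m+1))" for i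
  define E where "E n = (\<Prod>i<n. 1 + ?X ^ (2*i+2))" for n
  define O' where "O' n = (\<Prod>i<n. 1 + ?X ^ (2*i+1))" for n
  define D where "D = (\<Prod>i<L. 1 - ?X ^ (2*i+1))"
  define F where "F = (\<Prod>i<L. 1 - ?X ^ (2*i+2))"
  define S where "S = (1 + 2 * (\<Sum>s=1..2*L. ?X ^ s\<^sup>2))"
  let ?d = "\<lambda>f. ?X ^ (2*L) dvd f"
  \<comment> \<open>Positivity of \<open>i\<close> makes the truncation error divisible by
    \<open>fps_X ^ (2*L)\<close>.\<close>
  have step: "?d ((1 + ?X ^ (2*i)) * G i - (1 + ?X ^ (2*i+1)) * G (Suc i))" if "i > 0" for i
  proof -
    have "?X\<^sup>2 * - (?X ^ (2*i)) = - (?X ^ (2 * Suc i))"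
      by (simp add: power2_eq_square)
    then have "(1 + ?X ^ (2*i)) * G i - (1 + ?X ^ (2*i+1)) * G (Suc i) =
        - ((- (?X ^ (2*i))) ^ L * ((1 - ?X ^ (2*L)) * parts_ge_fps (2*L+1)))"
      using sum_parts_ge_fps_functional_equation[of "- (?X ^ (2*i))" L]
      by (simp add: G_def del: mult_Suc_right)
    moreover have "?d ((- (?X ^ (2*i))) ^ L)"
    proof -
      have "2 * L \<le> 2 * i * L" using that by simp
      then show ?thesis
        unfolding power_minus[of "?X ^ (2*i)"] power_mult[symmetric]
        by (intro dvd_mult le_imp_power_dvd)
    qed
    ultimately show ?thesis by (simp only: dvd_minus_iff dvd_mult2)
  qed
  \<comment> \<open>The iteration starts at \<open>G 1\<close>; the extra factor
    \<open>1 + ?X\<close> supplies the factor of \<open>O'\<close> with index 0.\<close>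
  have iter: "?d ((1 + ?X) * E n * G 1 - O' (Suc n) * G (Suc n))" for n
  proof (induction n)
    case (Suc n)
    have "(1 + ?X) * E (Suc n) * G 1 - O' (Suc (Suc n)) * G (Suc (Suc n)) =
      (1 + ?X ^ (2 * Suc n)) * ((1 + ?X) * E n * G 1 - O' (Suc n) * G (Suc n)) +
      O' (Suc n) * ((1 + ?X ^ (2 * Suc n)) * G (Suc n) - (1 + ?X ^ (2 * Suc n + 1)) * G (Suc (Suc n)))"
    proof -
      have "E (Suc n) = E n * (1 + ?X ^ (2 * Suc n))"
        "O' (Suc (Suc n)) = O' (Suc n) * (1 + ?X ^ (2 * Suc n + 1))"
        by (simp_all add: E_def O'_def)
      moreover have "b * (e * c) * g - u * d * h = c * (b * e * g - u * k) + u * (c * k - d * h)"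
        for b c d e g h k u :: "int fps"
        by (simp add: algebra_simps)
      ultimately show ?thesis by (simp only:)
    qed
    then show ?case using Suc.IH step[of "Suc n"] by (simp only: dvd_add dvd_mult zero_less_Suc)
  qed (simp add: E_def O'_def)
  \<comment> \<open>Only the term \<open>m = 0\<close> survives modulo
    \<open>fps_X ^ (2*L)\<close>.\<close>
  have G0: "?d (G (Suc L) - parts_ge_fps 1)"
  proof -
    obtain l where l: "L = Suc l" using False by (cases L) auto
    have "G (Suc L) - parts_ge_fps 1 =
        (\<Sum>m<l. (- (?X ^ (2 * Suc L))) ^ Suc m * parts_ge_fps (2 * Suc m + 1))"
      unfolding G_def l sum.lessThan_Suc_shift by simp
    moreover have "?d ((- (?X ^ (2 * Suc L))) ^ Suc m)" for m
      unfolding power_minus[of "?X ^ (2 * Suc L)"] power_mult[symmetric]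
      by (intro dvd_mult le_imp_power_dvd) simp
    ultimately show ?thesis by (simp add: dvd_sum dvd_mult2 del: power_Suc)
  qed
  have O: "?d (O' (Suc L) - O' L)"
    by (simp add: O'_def algebra_simps power_add)
  have A: "?d (parts_ge_fps (2*L+1) - 1)"
    by (rule dvd_trans[OF le_imp_power_dvd parts_ge_fps_dvd]) simp_all
  have gauss: "?d (E L * D * S - F * O' L)"
    using gauss_identity[of L] by (simp only: E_def D_def S_def F_def O'_def)
  have DF: "?d (D * parts_ge_fps 1 - F * parts_ge_fps (2*L+1))"
    using prod_mult_parts_ge_fps by (simp only: D_def F_def diff_self dvd_0_right)
  \<comment> \<open>A chain of congruences: \<open>iter\<close> leads to \<open>G (Suc L)\<close>,
    \<open>G0\<close> to \<open>parts_ge_fps 1\<close>, \<open>DF\<close> and \<open>A\<close> to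
    the product \<open>F\<close>, \<open>O\<close> drops the last factor of \<open>O'\<close>, and
    \<open>gauss\<close> brings in \<open>S\<close>.\<close>
  have "E L * D * ((1 + ?X) * G 1 - S) =
      D * ((1 + ?X) * E L * G 1 - O' (Suc L) * G (Suc L))
      + D * O' (Suc L) * (G (Suc L) - parts_ge_fps 1)
      + O' (Suc L) * (D * parts_ge_fps 1 - F * parts_ge_fps (2*L+1))
      + O' (Suc L) * F * (parts_ge_fps (2*L+1) - 1)
      + F * (O' (Suc L) - O' L) - (E L * D * S - F * O' L)"
  proof -
    have "e * d * ((1 + x) * g - s) = d * ((1 + x) * e * g - u * k) + d * u * (k - p)
        + u * (d * p - f * q) + u * f * (q - 1) + f * (u - v) - (e * d * s - f * v)"
      for d e f g k p q s u v x :: "int fps"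
      by (simp add: algebra_simps)
    then show ?thesis .
  qed
  moreover have "?d \<dots>"
    by (rule dvd_diff[OF dvd_add[OF dvd_add[OF dvd_add[OF dvd_add]]]]) (intro dvd_mult iter G0 DF A O gauss)+
  ultimately have "?d (E L * D * ((1 + ?X) * G 1 - S))" by (simp only:)
  moreover have "(E L * D) $ 0 \<noteq> 0"
  proof -
    have "E n $ 0 = 1" "(\<Prod>i<n. 1 - ?X ^ (2*i+1)) $ 0 = 1" for n
      unfolding E_def by (induction n) simp_all
    then show ?thesis by (simp add: D_def)
  qed
  ultimately have "?d ((1 + ?X) * G 1 - S)"
    by (rule fps_X_power_dvd_mult_cancel)
  moreover have "(- (?X ^ (2*1))) ^ m = (-1) ^ m * ?X ^ (2*m)" for m
    unfolding power_minus[of "?X ^ (2*1)"] power_mult[symmetric] by simp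
  ultimately show ?thesis by (simp only: G_def S_def)
qed simp

section \<open>Splitting by the smallest part, and conclusion\<close>

text \<open>A number is 2 or 3 modulo 4 exactly if its half, rounded down, is odd; the smallest part
  is then \<open>2*m\<close> or \<open>2*m+1\<close>.\<close>

lemma Pset_smallest:
  assumes "odd m" "r = 2 \<or> r = 3"
  shows "{p \<in> Pset r. sum_list p = N \<and> Min (set p) div 2 = m} =
    {p \<in> parts_ge (2*m+r-2) N. 2*m+r-2 \<in> set p}"
proof -
  obtain k where m: "m = 2*k+1" using assms(1) by (rule oddE)
  have "n mod 4 = r mod 4 \<and> n div 2 = m \<longleftrightarrow> n = 2*m+r-2" for n
    using assms(2) unfolding m by (elim disjE; simp; presburger)
  moreover have "p \<noteq> [] \<and> Min (set p) = n \<longleftrightarrow> n \<in> set p \<and> (\<forall>x\<in>set p. n \<le> x)" for p and n :: nat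
    by (cases "p = []") (auto simp: Min_eq_iff)
  ultimately show ?thesis
    unfolding Pset_def parts_ge_def by blast
qed

text \<open>Both residues lead to the same series: after removing a smallest part \<open>2*m\<close>
  or one copy of \<open>2*m+1\<close>, the remaining parts are at least \<open>2*m+1\<close>. Any
  \<open>L\<close> above \<open>N\<close> bounds the occurring \<open>m\<close>.\<close>

lemma sum_Pset:
  assumes "r = 2 \<or> r = 3" "N < L"
  shows "(\<Sum>p | p \<in> Pset r \<and> sum_list p = N. (-1) ^ nu_e p) =
    (\<Sum>m | m < L \<and> odd m. - ((-1) ^ r) * fps_X ^ (2*m+r-2) * parts_ge_fps (2*m+1)) $ N"
proof -
  let ?S = "{p. p \<in> Pset r \<and> sum_list p = N}"
  let ?T = "{m. m < L \<and> odd m}"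
  have fin: "finite ?S"
    by (rule finite_subset[OF _ finite_partitions[of N]]) (auto simp: Pset_def)
  have "(\<lambda>p. Min (set p) div 2) ` ?S \<subseteq> ?T"
  proof (intro image_subsetI CollectI conjI)
    fix p assume p: "p \<in> ?S"
    then have "Min (set p) \<in> set p" by (simp add: Pset_def)
    then have "Min (set p) \<le> N" using p by (auto dest: member_le_sum_list)
    then show "Min (set p) div 2 < L" using assms(2) by linarith
    have "Min (set p) mod 4 = r mod 4" using p by (simp add: Pset_def)
    then show "odd (Min (set p) div 2)" using assms(1) by presburger
  qed
  then have "(\<Sum>p\<in>?S. (-1::int) ^ nu_e p) =
      (\<Sum>m\<in>?T. \<Sum>p | p \<in> ?S \<and> Min (set p) div 2 = m. (-1) ^ nu_e p)"
    using fin by (intro sum.group[symmetric]) auto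
  also have "\<dots> = (\<Sum>m\<in>?T. (- ((-1) ^ r) * fps_X ^ (2*m+r-2) * parts_ge_fps (2*m+1)) $ N)"
  proof (rule sum.cong[OF refl])
    fix m assume "m \<in> ?T"
    then have m: "odd m" "m > 0" by (auto intro: odd_pos)
    have "{p. p \<in> ?S \<and> Min (set p) div 2 = m} = {p \<in> parts_ge (2*m+r-2) N. 2*m+r-2 \<in> set p}"
      using Pset_smallest[OF m(1) assms(1)] by auto
    moreover have "(if odd (2*m+r-2) then 2*m+r-2 else Suc (2*m+r-2)) = 2*m+1"
      "(-1) ^ (2*m+r-2) = ((-1) ^ r :: int fps)"
      using assms(1) by auto
    ultimately show "(\<Sum>p | p \<in> ?S \<and> Min (set p) div 2 = m. (-1) ^ nu_e p) =
        (- ((-1) ^ r) * fps_X ^ (2*m+r-2) * parts_ge_fps (2*m+1)) $ N"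
      using sum_parts_ge_smallest[of "2*m+r-2" N] m assms(1) by auto
  qed
  finally show ?thesis by (simp add: fps_sum_nth)
qed

theorem theorem5p8:
  fixes N :: nat
  assumes "N > 0"
  shows "(\<Sum>p | p \<in> Pset 3 \<and> sum_list p = N. (-1::int) ^ nu_e p)
       - (\<Sum>p | p \<in> Pset 2 \<and> sum_list p = N. (-1::int) ^ nu_e p)
       = of_bool (\<not> (\<exists>k::nat. N = k\<^sup>2))"
proof -
  \<comment> \<open>This gives both \<open>N < L\<close> for the grouping and
    \<open>N < 2*L\<close>, so that coefficient \<open>N\<close> is determined modulo
    \<open>fps_X ^ (2*L)\<close>.\<close>
  define L where "L = Suc N"
  let ?X = "fps_X :: int fps"
  let ?d = "\<lambda>f. ?X ^ (2*L) dvd f"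
  define a where "a m = parts_ge_fps (2*m+1)" for m
  define H where "H = (\<Sum>m | m < L \<and> odd m. (1 + ?X) * (?X ^ (2*m) * a m))"
  define T where "T = (\<Sum>m<L. ?X ^ (2*m) * a m)"
  define U where "U = (\<Sum>m<L. (-1) ^ m * ?X ^ (2*m) * a m)"
  define Q where "Q = (\<Sum>s=1..2*L. ?X ^ s\<^sup>2)"
  \<comment> \<open>This is the expansion of q/(1 - q).\<close>
  define F where "F = Abs_fps (\<lambda>n. of_bool (n > 0) :: int)"
  have Q: "Q $ N = of_bool (\<exists>k. N = k\<^sup>2)"
  proof (cases "\<exists>k. N = k\<^sup>2")
    case True
    then obtain k where k: "N = k\<^sup>2" by blast
    have "k > 0" using k assms by (cases k) auto
    moreover have "k \<le> N" unfolding k power2_eq_square by simp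
    ultimately have "k \<in> {1..2*L}" by (simp add: L_def)
    moreover have "N = s\<^sup>2 \<longleftrightarrow> s = k" for s unfolding k by auto
    ultimately show ?thesis using True
      by (simp add: Q_def fps_sum_nth)
  next
    case False
    then show ?thesis by (simp add: Q_def fps_sum_nth)
  qed
  have "(\<Sum>p | p \<in> Pset 3 \<and> sum_list p = N. (-1::int) ^ nu_e p)
       - (\<Sum>p | p \<in> Pset 2 \<and> sum_list p = N. (-1::int) ^ nu_e p) = H $ N"
  proof -
    have "H = (\<Sum>m | m < L \<and> odd m. - ((-1) ^ 3) * ?X ^ (2*m+3-2) * a m)
        - (\<Sum>m | m < L \<and> odd m. - ((-1) ^ 2) * ?X ^ (2*m+2-2) * a m)"
      unfolding H_def sum_subtractf[symmetric]
      by (intro sum.cong refl) (simp add: ring_distribs mult.assoc)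
    moreover have "N < L" by (simp add: L_def)
    ultimately show ?thesis
      by (simp only: sum_Pset[of 3 N L] sum_Pset[of 2 N L] a_def fps_sub_nth simp_thms)
  qed
  also have "H $ N = (F - Q) $ N"
  proof -
    \<comment> \<open>Even indices cancel and odd ones double.\<close>
    have "T - U = (\<Sum>m<L. if odd m then 2 * (?X ^ (2*m) * a m) else 0)"
      unfolding T_def U_def sum_subtractf[symmetric] by (intro sum.cong) auto
    also have "\<dots> = 2 * (\<Sum>m | m < L \<and> odd m. ?X ^ (2*m) * a m)"
      by (simp add: sum.If_cases sum_distrib_left Int_def)
    finally have TU: "2 * H = (1 + ?X) * (T - U)"
      by (simp add: H_def sum_distrib_left mult_ac)
    have F: "(1 - ?X) * F = ?X"
      by (rule fps_ext) (auto simp: F_def left_diff_distrib fps_X_nth)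
    have T: "(1 - ?X) * T = (1 - ?X ^ (2*L)) * a L"
      using sum_parts_ge_fps_telescope by (simp only: T_def a_def)
    have U: "?d ((1 + ?X) * U - (1 + 2 * Q))"
      using alternating_sum_parts_ge_fps[of L] by (simp only: U_def a_def Q_def)
    have A: "?d (a L - 1)" unfolding a_def
      by (rule dvd_trans[OF le_imp_power_dvd parts_ge_fps_dvd]) simp_all
    \<comment> \<open>Multiplying by \<open>2 * (1 - ?X)\<close> clears all denominators. Modulo
      \<open>fps_X ^ (2*L)\<close>, \<open>(1 - ?X) * T\<close> is 1 and \<open>(1 + ?X) * U\<close>
      is \<open>1 + 2 * Q\<close>, and everything cancels.\<close>
    have "2 * (1 - ?X) * (H - (F - Q)) = (1 - ?X) * (2 * H) - 2 * ((1 - ?X) * F) + 2 * (1 - ?X) * Q"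
    proof -
      have "2 * y * (h - (f - q)) = y * (2 * h) - 2 * (y * f) + 2 * y * q" for f h q y :: "int fps"
        by (simp add: algebra_simps)
      then show ?thesis .
    qed
    also have "\<dots> = (1 + ?X) * ((1 - ?X) * T) - (1 - ?X) * ((1 + ?X) * U) - 2 * ?X + 2 * (1 - ?X) * Q"
      unfolding TU F by (simp only: right_diff_distrib mult.left_commute)
    also have "\<dots> = (1 + ?X) * (a L - 1) - ?X ^ (2*L) * ((1 + ?X) * a L)
        - (1 - ?X) * ((1 + ?X) * U - (1 + 2 * Q))"
    proof -
      have "(1 + x) * ((1 - y) * b) - (1 - x) * v - 2 * x + 2 * (1 - x) * q =
          (1 + x) * (b - 1) - y * ((1 + x) * b) - (1 - x) * (v - (1 + 2 * q))"
        for b q v x y :: "int fps"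
        by (simp add: algebra_simps)
      then show ?thesis unfolding T .
    qed
    finally have "2 * (1 - ?X) * (H - (F - Q)) = \<dots>" .
    moreover have "?d \<dots>"
      by (intro A U dvd_diff dvd_mult dvd_triv_left)
    ultimately have "?d (2 * (1 - ?X) * (H - (F - Q)))" by (simp only:)
    then have "?d (H - (F - Q))"
      by (rule fps_X_power_dvd_mult_cancel) (simp add: fps_mult_nth_0)
    then have "(H - (F - Q)) $ N = 0" unfolding fps_X_power_dvd_iff by (simp add: L_def)
    then show ?thesis by simp
  qed
  also have "\<dots> = of_bool (\<not> (\<exists>k. N = k\<^sup>2))"
    using assms by (simp add: F_def Q)
  finally show ?thesis .
qed

end
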